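(* Let $p$ be a prime and let $G$ be a $p$-group acting transitively on a set $X$. Suppose that $o_n(G,X)$ is unbounded (as a function of $n$). Then there exist infinitely many $m$ such that $$o_{p^m}(G,X)\geq (p-1)m+1.$$
   Context: A $p$-group is a (possibly infinite) group in which every element has order a power of $p$. For a group $G$ acting transitively on a set $X$, $o_n(G,X)$ is the maximal number of orbits on $X$ of a subgroup $U$ of index at most $n$ in $G$. *)

theory Defs
  imports "HOL-Algebra.Algebra" "HOL-Computational_Algebra.Primes"
begin

text \<open>
  The group may be infinite. Elements of infinite order are excluded, since the library assigns
  them the order 0, which is not a power of a prime.
\<close>

definition p_group :: "nat \<Rightarrow> ('a, 'b) monoid_scheme \<Rightarrow> bool"
  where "p_group p G \<longleftrightarrow> group G \<and> (\<forall>x\<in>carrier G. \<exists>k::nat. group.ord G x = p ^ k)"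

definition subgroup_of_index_at_most :: "('a, 'b) monoid_scheme \<Rightarrow> nat \<Rightarrow> 'a set \<Rightarrow> bool"
  where "subgroup_of_index_at_most G n U \<longleftrightarrow>
           subgroup U G \<and> finite (rcosets\<^bsub>G\<^esub> U) \<and> card (rcosets\<^bsub>G\<^esub> U) \<le> n"

text \<open>
  This is the number \<open>o\<^sub>n(G, E)\<close>. For a transitive action and \<open>n \<ge> 1\<close> the maximum is attained, and
  all orbit sets involved are finite; see the lemmas below. The value at \<open>n = 0\<close> is a
  maximum over the empty set and has no meaning.
\<close>

definition max_orbits ::
    "('a, 'b) monoid_scheme \<Rightarrow> 'c set \<Rightarrow> ('a \<Rightarrow> 'c \<Rightarrow> 'c) \<Rightarrow> nat \<Rightarrow> nat"
  where "max_orbits G E \<phi> n =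
           Max {card (orbits (G\<lparr>carrier := U\<rparr>) E \<phi>) | U. subgroup_of_index_at_most G n U}"

lemma (in transitive_action) orbits_subgroup_finite_index:
  assumes U: "subgroup U G" and fin: "finite (rcosets U)"
  shows "finite (orbits (G\<lparr>carrier := U\<rparr>) E \<phi>)"
    and "card (orbits (G\<lparr>carrier := U\<rparr>) E \<phi>) \<le> card (rcosets U)"
proof -
  interpret group G
    using group_hom group_hom.axioms(1) by auto
  have "\<exists>f. orbits (G\<lparr>carrier := U\<rparr>) E \<phi> \<subseteq> f ` (rcosets U)"
  proof (cases "E = {}")
    case True
    then show ?thesis by (simp add: orbits_def)
  next
    case False
    then obtain x0 where x0: "x0 \<in> E" by blast
    have "Q \<in> (\<lambda>C. (\<lambda>h. \<phi> h x0) ` C) ` (rcosets U)"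
      if Q: "Q \<in> orbits (G\<lparr>carrier := U\<rparr>) E \<phi>" for Q
    proof -
      obtain x where x: "x \<in> E" "Q = {\<phi> u x | u. u \<in> U}"
        using Q by (auto simp: orbits_def orbit_def)
      obtain g where g: "g \<in> carrier G" "\<phi> g x0 = x"
        using unique_orbit x0 x(1) by blast
      have "\<phi> (u \<otimes> g) x0 = \<phi> u x" if "u \<in> U" for u
        using composition_rule[OF x0, of u g] g that subgroup.mem_carrier[OF U] by simp
      then have "Q = (\<lambda>h. \<phi> h x0) ` (U #> g)"
        unfolding x(2) r_coset_def by force
      moreover have "U #> g \<in> rcosets U"
        using g(1) U by (simp add: rcosetsI subgroup.subset)
      ultimately show ?thesis by blast
    qed
    then show ?thesis by blast
  qed
  then obtain f where f: "orbits (G\<lparr>carrier := U\<rparr>) E \<phi> \<subseteq> f ` (rcosets U)" by blast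
  show "finite (orbits (G\<lparr>carrier := U\<rparr>) E \<phi>)"
    using f fin by (meson finite_imageI finite_subset)
  have "card (orbits (G\<lparr>carrier := U\<rparr>) E \<phi>) \<le> card (f ` (rcosets U))"
    using f fin by (simp add: card_mono)
  also have "\<dots> \<le> card (rcosets U)"
    using fin by (rule card_image_le)
  finally show "card (orbits (G\<lparr>carrier := U\<rparr>) E \<phi>) \<le> card (rcosets U)" .
qed

lemma (in transitive_action) max_orbits_well_defined:
  defines "S \<equiv> \<lambda>n. {card (orbits (G\<lparr>carrier := U\<rparr>) E \<phi>) | U. subgroup_of_index_at_most G n U}"
  shows "finite (S n)" and "n \<ge> 1 \<Longrightarrow> S n \<noteq> {}"
proof -
  interpret group G
    using group_hom group_hom.axioms(1) by auto
  have "S n \<subseteq> {..n}"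
    unfolding S_def subgroup_of_index_at_most_def
    using orbits_subgroup_finite_index(2) by fastforce
  then show "finite (S n)"
    by (rule finite_subset) simp
  assume n: "n \<ge> 1"
  have "C = carrier G" if "C \<in> rcosets (carrier G)" for C
  proof -
    obtain g where "g \<in> carrier G" "C = carrier G #> g"
      using \<open>C \<in> rcosets (carrier G)\<close> unfolding RCOSETS_def by blast
    then show ?thesis
      using coset_join2[OF _ subgroup_self] by simp
  qed
  then have sub: "rcosets (carrier G) \<subseteq> {carrier G}"
    by blast
  then have "finite (rcosets (carrier G))" "card (rcosets (carrier G)) \<le> 1"
    using finite_subset card_mono[OF _ sub] by auto
  then have "subgroup_of_index_at_most G n (carrier G)"
    using n subgroup_self by (simp add: subgroup_of_index_at_most_def)
  then show "S n \<noteq> {}"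
    unfolding S_def by blast
qed

end

theory Submission
  imports Defs
begin

text \<open>
  Every step down to a suitable subgroup of index \<open>p\<close> breaks an orbit into \<open>p\<close> pieces and so gains
  at least \<open>p - 1\<close> orbits. Starting from the single orbit of \<open>G\<close>, after \<open>m\<close> steps there is a
  subgroup of index at most \<open>p\<^sup>m\<close> with at least \<open>(p - 1) m + 1\<close> orbits, provided that the descent
  does not get stuck. The inequality is thus obtained for every \<open>m\<close>.

  What keeps the descent going is a normal subgroup \<open>N\<close> of finite index with at least
  \<open>(p - 1) m + 1\<close> orbits. Since the numbers \<open>o\<^sub>n\<close> are unbounded, there is a subgroup of finite index
  with that many orbits, and its normal core has finite index and no fewer orbits
  (\<open>finite_index_contains_normal\<close>, \<open>card_orbits_subgroup_mono\<close>). The whole descent takes place above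
  \<open>N\<close>. If \<open>U \<supseteq> N\<close> has fewer orbits than \<open>N\<close>, then some orbit \<open>U x\<close> is larger than \<open>N x\<close>, so
  \<open>N U\<^sub>x\<close>, where \<open>U\<^sub>x\<close> is the stabilizer of \<open>x\<close> in \<open>U\<close>, is a proper subgroup of finite index in \<open>U\<close>.
  As in a finite \<open>p\<close>-group, it lies in a normal subgroup of \<open>U\<close> of index \<open>p\<close>
  (\<open>p_group_normal_index_p\<close>), which has exactly \<open>p\<close> orbits on \<open>U x\<close>
  (\<open>normal_subgroup_splits_orbit\<close>, \<open>p_group_gain_orbits\<close>).

  The existence of that subgroup of index \<open>p\<close> rests on counting fixed points modulo \<open>p\<close>: for a
  \<open>p\<close>-group acting on a finite set, the number of points that move is divisible by \<open>p\<close>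
  (\<open>p_group_dvd_card_moved_points\<close>). Applied to coset spaces, this shows that normalizers of proper
  subgroups of finite index grow, so that maximal ones are normal.
\<close>

section \<open>Groups of prime power torsion\<close>

lemma p_groupI:
  assumes "group G" and "\<And>x. x \<in> carrier G \<Longrightarrow> \<exists>k::nat. x [^]\<^bsub>G\<^esub> (p ^ k) = \<one>\<^bsub>G\<^esub>"
    and "Factorial_Ring.prime p"
  shows "p_group p G"
  unfolding p_group_def using assms by (metis divides_primepow_nat group.pow_eq_id)

lemma p_group_pow_eq_one:
  assumes "p_group p G" "x \<in> carrier G"
  obtains k :: nat where "x [^]\<^bsub>G\<^esub> (p ^ k) = \<one>\<^bsub>G\<^esub>"
  using assms unfolding p_group_def by (metis group.pow_ord_eq_1)

lemma p_group_subgroup: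
  fixes G (structure)
  assumes "Factorial_Ring.prime p" "p_group p G" "subgroup H G"
  shows "p_group p (G\<lparr>carrier := H\<rparr>)"
proof (rule p_groupI)
  interpret group G using assms(2) by (simp add: p_group_def)
  show "group (G\<lparr>carrier := H\<rparr>)" using assms(3) by (rule subgroup_imp_group)
  fix x assume "x \<in> carrier (G\<lparr>carrier := H\<rparr>)"
  then have "x \<in> carrier G" using subgroup.subset[OF assms(3)] by auto
  then obtain k :: nat where "x [^] (p ^ k) = \<one>" using p_group_pow_eq_one[OF assms(2)] by blast
  then show "\<exists>k::nat. x [^]\<^bsub>G\<lparr>carrier := H\<rparr>\<^esub> (p ^ k) = \<one>\<^bsub>G\<lparr>carrier := H\<rparr>\<^esub>"
    by (auto simp flip: nat_pow_consistent)
qed (fact assms(1))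

lemma p_group_hom_image:
  assumes "Factorial_Ring.prime p" "p_group p G" "group_hom G K h"
  shows "p_group p (K\<lparr>carrier := h ` carrier G\<rparr>)"
proof (rule p_groupI)
  interpret group_hom G K h by fact
  show "group (K\<lparr>carrier := h ` carrier G\<rparr>)"
    using img_is_subgroup by (rule H.subgroup_imp_group)
  fix y assume "y \<in> carrier (K\<lparr>carrier := h ` carrier G\<rparr>)"
  then obtain x where x: "x \<in> carrier G" "y = h x" by auto
  then obtain k :: nat where "x [^]\<^bsub>G\<^esub> (p ^ k) = \<one>\<^bsub>G\<^esub>"
    using p_group_pow_eq_one[OF assms(2)] by metis
  then have "y [^]\<^bsub>K\<^esub> (p ^ k) = \<one>\<^bsub>K\<^esub>" using x by (metis hom_nat_pow hom_one)
  then show "\<exists>k::nat. y [^]\<^bsub>K\<lparr>carrier := h ` carrier G\<rparr>\<^esub> (p ^ k) = \<one>\<^bsub>K\<lparr>carrier := h ` carrier G\<rparr>\<^esub>"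
    by (auto simp flip: H.nat_pow_consistent)
qed (fact assms(1))

text \<open>
  A prime \<open>q\<close> dividing the order gives, by Sylow, a subgroup with \<open>q\<close> elements. A nontrivial
  element of it has order \<open>q\<close>, and this order is also a power of \<open>p\<close>; hence \<open>q = p\<close>.
\<close>

lemma finite_p_group_order:
  fixes G (structure)
  assumes p: "Factorial_Ring.prime p" and G: "p_group p G" and fin: "finite (carrier G)"
  obtains n where "order G = p ^ n"
proof -
  interpret group G using G by (simp add: p_group_def)
  have pos: "order G > 0" using fin order_gt_0_iff_finite by simp
  have "q = p" if q: "Factorial_Ring.prime q" "q dvd order G" for q
  proof -
    obtain m where "order G = q ^ 1 * m" using q(2) by auto
    then obtain H where H: "subgroup H G" "card H = q"
      using sylow_thm[OF q(1) is_group _ fin] by (metis power_one_right)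
    have "H \<noteq> {\<one>}" using H(2) q(1) by auto
    then obtain x where x: "x \<in> H" "x \<noteq> \<one>" using subgroup.one_closed[OF H(1)] by blast
    then have xG: "x \<in> carrier G" using H(1) subgroup.mem_carrier by metis
    have "x [^]\<^bsub>G\<lparr>carrier := H\<rparr>\<^esub> order (G\<lparr>carrier := H\<rparr>) = \<one>"
      using group.pow_order_eq_1[OF subgroup_imp_group[OF H(1)]] x(1) by simp
    then have "x [^] q = \<one>" using H(2) nat_pow_consistent by (simp add: order_def)
    then have "ord x dvd q" using pow_eq_id xG by blast
    moreover have "ord x \<noteq> 1" using ord_eq_1 xG x(2) by blast
    ultimately have "ord x = q" using q(1) by (meson prime_nat_iff)
    moreover obtain k where "ord x = p ^ k" using G xG unfolding p_group_def by blast
    ultimately show "q = p" using p q(1)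
      by (metis prime_dvd_power primes_dvd_imp_eq dvd_refl)
  qed
  moreover obtain k m where "order G = p ^ k * m" "\<not> p dvd m"
    using multiplicity_decompose'[of "order G" p] pos p not_prime_unit by (metis neq0_conv)
  ultimately have "order G = p ^ k"
    by (metis dvd_mult mult_1_right prime_factor_nat)
  then show thesis by (rule that)
qed

text \<open>
  In a torsion group inverses are positive powers. This is what makes one-sided conditions such
  as \<open>g M g\<inverse> \<subseteq> M\<close>, for a possibly infinite \<open>M\<close>, define subgroups.
\<close>

lemma p_group_submonoid_is_subgroup:
  fixes G (structure)
  assumes p: "Factorial_Ring.prime p" and G: "p_group p G" and L: "submonoid L G"
  shows "subgroup L G"
proof -
  interpret group G using G by (simp add: p_group_def)
  interpret L: submonoid L G by fact
  show ?thesis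
  proof (rule submonoid_subgroupI[OF L])
    fix a assume a: "a \<in> L"
    then have aG: "a \<in> carrier G" using L.subset by blast
    obtain k :: nat where k: "a [^] (p ^ k) = \<one>" using p_group_pow_eq_one[OF G aG] by blast
    have pow: "a [^] n \<in> L" for n :: nat by (induction n) (use a in auto)
    have "p ^ k > 0" using p prime_gt_0_nat by simp
    then have "a [^] (p ^ k - 1) \<otimes> a = \<one>" using k by (metis Suc_diff_1 nat_pow_Suc)
    then have "inv a = a [^] (p ^ k - 1)" using aG by (simp add: inv_equality)
    then show "inv a \<in> L" using pow by simp
  qed
qed

section \<open>Counting fixed points\<close>

lemma finite_Bij:
  assumes fin: "finite E"
  shows "finite (Bij E)"
  by (rule finite_subset[OF _ finite_PiE[OF fin, of "\<lambda>_. E"]])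
     (use fin in \<open>auto simp: Bij_def PiE_def bij_betw_def\<close>)

text \<open>
  The points that are not fixed form a union of orbits with more than one element, so it is
  enough that the size of a finite orbit is a power of \<open>p\<close>. As \<open>G\<close> may be infinite, orbit sizes
  are compared not with the order of \<open>G\<close> but with that of its image in the symmetric group on
  \<open>E\<close>, which is a finite \<open>p\<close>-group with the same orbits.
\<close>

lemma p_group_dvd_card_moved_points:
  assumes p: "Factorial_Ring.prime p" and G: "p_group p G"
    and act: "group_action G E \<phi>" and fin: "finite E"
  shows "p dvd card {x \<in> E. \<exists>g\<in>carrier G. \<phi> g x \<noteq> x}"
proof -
  interpret group_action G E \<phi> by fact
  let ?K = "BijGroup E\<lparr>carrier := \<phi> ` carrier G\<rparr>"
  have "finite (carrier ?K)"
    using bij_prop0 finite_Bij[OF fin] by (auto intro: finite_subset[of _ "Bij E"])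
  moreover have "p_group p ?K" using p_group_hom_image[OF p G group_hom] .
  ultimately obtain n where n: "order ?K = p ^ n" using finite_p_group_order[OF p] by metis
  have "group_action (BijGroup E) E (\<lambda>f. f)"
    unfolding group_action_def group_hom_def group_hom_axioms_def
    using group_BijGroup by (auto simp: hom_def Bij_def)
  then interpret K: group_action ?K E "\<lambda>f. f"
    using group_action.induced_action group_hom.img_is_subgroup[OF group_hom] by blast
  have orbit: "orbit ?K (\<lambda>f. f) x = orbit G \<phi> x" for x
    by (auto simp: orbit_def)
  define C where "C = {Q \<in> orbits G E \<phi>. card Q \<noteq> 1}"
  have "p dvd card Q" if "Q \<in> C" for Q
  proof -
    obtain x where x: "x \<in> E" "Q = orbit G \<phi> x" using \<open>Q \<in> C\<close> by (auto simp: C_def orbits_def)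
    have "card Q dvd p ^ n"
      using K.orbit_stabilizer_theorem[OF x(1)] x(2) orbit n by (metis dvd_triv_left)
    then show ?thesis using \<open>Q \<in> C\<close> p divides_primepow_nat[OF p]
      by (metis (mono_tags, lifting) C_def dvd_power mem_Collect_eq neq0_conv power_0)
  qed
  moreover have U: "\<Union> C = {x \<in> E. \<exists>g\<in>carrier G. \<phi> g x \<noteq> x}"
  proof -
    have *: "card (orbit G \<phi> x) = 1 \<longleftrightarrow> (\<forall>g\<in>carrier G. \<phi> g x = x)" if "x \<in> E" for x
    proof -
      have "x \<in> orbit G \<phi> x" using orbit_refl that .
      then have "card (orbit G \<phi> x) = 1 \<longleftrightarrow> orbit G \<phi> x \<subseteq> {x}"
        by (auto simp: card_1_singleton_iff)
      then show ?thesis by (auto simp: orbit_def)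
    qed
    have E: "\<Union> (orbits G E \<phi>) = E" by (rule orbits_coverture)
    have same: "Q = orbit G \<phi> x" if "Q \<in> orbits G E \<phi>" "x \<in> Q" for Q x
    proof -
      have "x \<in> E" using that E by blast
      then show ?thesis using disjoint_union[OF that(1), of "orbit G \<phi> x"] that orbit_refl
        by (auto simp: orbits_def)
    qed
    show ?thesis
    proof (intro equalityI subsetI)
      fix x assume "x \<in> \<Union> C"
      then obtain Q where "Q \<in> C" "x \<in> Q" by blast
      then show "x \<in> {x \<in> E. \<exists>g\<in>carrier G. \<phi> g x \<noteq> x}"
        using same[of Q x] *[of x] E unfolding C_def by auto
    next
      fix x assume "x \<in> {x \<in> E. \<exists>g\<in>carrier G. \<phi> g x \<noteq> x}"
      then have "x \<in> E" "orbit G \<phi> x \<in> C" using * by (auto simp: C_def orbits_def)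
      then show "x \<in> \<Union> C" using orbit_refl by blast
    qed
  qed
  moreover have "\<forall>c1\<in>C. \<forall>c2\<in>C. c1 \<noteq> c2 \<longrightarrow> c1 \<inter> c2 = {}"
    using disjoint_union by (auto simp: C_def)
  ultimately show ?thesis
    using dvd_partition[of C p] fin by simp
qed

section \<open>Subgroups of finite index\<close>

text \<open>
  Multiplication on the right is a right action; the inverse turns it into a left action.
\<close>

lemma (in group) coset_action:
  assumes H: "subgroup H G"
  shows "group_action G (rcosets H) (\<lambda>g. \<lambda>C\<in>rcosets H. C #> inv g)"
proof -
  have sub: "C \<subseteq> carrier G" if "C \<in> rcosets H" for C
    using subgroup.rcosets_carrier[OF H is_group that] .
  have cl: "C #> g \<in> rcosets H" if "C \<in> rcosets H" "g \<in> carrier G" for C g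
    using that subgroup.subset[OF H] unfolding RCOSETS_def
    by (auto simp: coset_mult_assoc)
  have bij: "bij_betw (\<lambda>C\<in>rcosets H. C #> inv g) (rcosets H) (rcosets H)" if "g \<in> carrier G" for g
    by (rule bij_betw_byWitness[where f' = "\<lambda>C. C #> g"])
       (use that cl sub in \<open>auto simp: coset_mult_assoc\<close>)
  have B: "(\<lambda>C\<in>rcosets H. C #> inv g) \<in> Bij (rcosets H)" if "g \<in> carrier G" for g
    using bij[OF that] by (simp add: Bij_def)
  have "(\<lambda>g. \<lambda>C\<in>rcosets H. C #> inv g) \<in> hom G (BijGroup (rcosets H))"
    unfolding hom_def using B
    by (auto simp: BijGroup_def compose_def fun_eq_iff cl coset_mult_assoc sub inv_mult_group)
  then show ?thesis
    by (simp add: group_action_def group_hom_def group_hom_axioms_def group_BijGroup is_group)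
qed

text \<open>
  The kernel of the action on the cosets of \<open>H\<close> fixes the coset \<open>H\<close>, so it lies in \<open>H\<close>, and it
  has finite index because the group of permutations of the cosets is finite.
\<close>

lemma (in group) finite_index_contains_normal:
  assumes H: "subgroup H G" and fin: "finite (rcosets H)"
  obtains N where "N \<lhd> G" "N \<subseteq> H" "finite (rcosets N)"
proof -
  let ?\<phi> = "\<lambda>g. \<lambda>C\<in>rcosets H. C #> inv g"
  interpret group_action G "rcosets H" ?\<phi> using H by (rule coset_action)
  let ?N = "kernel G (BijGroup (rcosets H)) ?\<phi>"
  interpret h: group_hom G "BijGroup (rcosets H)" ?\<phi> using group_hom .
  have "finite (Bij (rcosets H))" using fin by (rule finite_Bij)
  moreover have "(\<lambda>Y. the_elem (?\<phi> ` Y)) ` carrier (G Mod ?N) \<subseteq> Bij (rcosets H)"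
    using h.FactGroup_the_elem_mem by (auto simp: BijGroup_def)
  ultimately have "finite (carrier (G Mod ?N))"
    using h.FactGroup_inj_on by (meson finite_imageD finite_subset)
  moreover have "?N \<subseteq> H"
  proof
    fix g assume "g \<in> ?N"
    then have g: "g \<in> carrier G" "?\<phi> g = (\<lambda>C\<in>rcosets H. C)"
      by (auto simp: kernel_def BijGroup_def)
    have "H \<in> rcosets H" using subgroup.subgroup_in_rcosets[OF H is_group] .
    then have "H #> inv g = H" using fun_cong[OF g(2), of H] by simp
    then have "inv g \<in> H" using g(1) by (metis H inv_closed rcos_self)
    then show "g \<in> H" using g(1) H by (metis inv_inv subgroup.m_inv_closed)
  qed
  ultimately show thesis using h.normal_kernel that by (simp add: FactGroup_def)
qed

lemma (in group) finite_rcosets_supergroup: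
  assumes H: "subgroup H G" and L: "subgroup L G" and "H \<subseteq> L" and fin: "finite (rcosets H)"
  shows "finite (rcosets L)"
proof (rule finite_surj[OF fin])
  have "L #> g = L <#> (H #> g)" if g: "g \<in> carrier G" for g
  proof -
    have "L <#> H = L"
    proof -
      have "l \<otimes> \<one> \<in> L <#> H" if "l \<in> L" for l
        using that subgroup.one_closed[OF H] by (auto simp: set_mult_def)
      then show ?thesis
        using subgroup.m_closed[OF L] \<open>H \<subseteq> L\<close> subgroup.mem_carrier[OF L] by (auto simp: set_mult_def)
    qed
    then show ?thesis
      using setmult_rcos_assoc[OF subgroup.subset[OF L] subgroup.subset[OF H] g] by simp
  qed
  then show "rcosets L \<subseteq> (\<lambda>C. L <#> C) ` (rcosets H)" by (auto simp: RCOSETS_def)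
qed

text \<open>
  A subgroup containing \<open>H\<close> is a union of cosets of \<open>H\<close>. Hence maximal proper subgroups above a
  subgroup of finite index exist, even though \<open>G\<close> may be infinite.
\<close>

lemma (in group) finite_supergroups:
  assumes H: "subgroup H G" and fin: "finite (rcosets H)"
  shows "finite {L. subgroup L G \<and> H \<subseteq> L}"
proof (rule finite_subset)
  show "finite (Union ` Pow (rcosets H))" using fin by simp
  have "L = \<Union> {C \<in> rcosets H. C \<subseteq> L}" if L: "subgroup L G" "H \<subseteq> L" for L
  proof -
    have "l \<in> H #> l" "H #> l \<in> rcosets H" "H #> l \<subseteq> L" if "l \<in> L" for l
      using that L subgroup.mem_carrier[OF L(1)] subgroup.m_closed[OF L(1)] rcos_self[OF _ H]
        rcosetsI[OF subgroup.subset[OF H]] by (auto simp: r_coset_def)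
    then show ?thesis by blast
  qed
  then show "{L. subgroup L G \<and> H \<subseteq> L} \<subseteq> Union ` Pow (rcosets H)" by blast
qed

lemma (in group) card_rcosets_tower:
  assumes U: "subgroup U G" and M: "subgroup M G" and MU: "M \<subseteq> U"
    and finU: "finite (rcosets U)" and finM: "finite (rcosets\<^bsub>G\<lparr>carrier := U\<rparr>\<^esub> M)"
  shows "finite (rcosets M)"
    and "card (rcosets M) \<le> card (rcosets\<^bsub>G\<lparr>carrier := U\<rparr>\<^esub> M) * card (rcosets U)"
proof -
  let ?R = "rcosets\<^bsub>G\<lparr>carrier := U\<rparr>\<^esub> M"
  let ?f = "\<lambda>(C, D). C #> (SOME g. g \<in> D)"
  have sub: "rcosets M \<subseteq> ?f ` (?R \<times> rcosets U)"
  proof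
    fix C assume "C \<in> rcosets M"
    then obtain h where h: "h \<in> carrier G" "C = M #> h" by (auto simp: RCOSETS_def)
    define g where "g = (SOME g. g \<in> U #> h)"
    have g: "g \<in> U #> h" unfolding g_def using rcos_self[OF h(1) U] by (rule someI)
    then have gG: "g \<in> carrier G" using subgroup.elemrcos_carrier[OF U is_group h(1)] by blast
    have "h \<in> U #> g" using repr_independence[OF g h(1) U] rcos_self[OF h(1) U] by simp
    then obtain u where u: "u \<in> U" "h = u \<otimes> g" by (auto simp: r_coset_def)
    then have "C = (M #> u) #> g"
      using h gG subgroup.mem_carrier[OF U] subgroup.subset[OF M] by (simp add: coset_mult_assoc)
    moreover have "M #> u \<in> ?R" using u(1) by (auto simp: RCOSETS_def)
    moreover have "U #> h \<in> rcosets U" using rcosetsI[OF subgroup.subset[OF U] h(1)] .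
    ultimately show "C \<in> ?f ` (?R \<times> rcosets U)"
      by (intro image_eqI[of _ _ "(M #> u, U #> h)"]) (simp_all add: g_def)
  qed
  show "finite (rcosets M)" using finite_subset[OF sub] finU finM by simp
  have "card (rcosets M) \<le> card (?R \<times> rcosets U)" using surj_card_le[OF _ sub] finU finM by simp
  then show "card (rcosets M) \<le> card ?R * card (rcosets U)" by (simp add: card_cartesian_product)
qed

section \<open>Normal subgroups of index \<open>p\<close>\<close>

text \<open>
  The action of \<open>G\<close> on the cosets of a proper subgroup is transitive on more than one point, so
  it has no fixed points.
\<close>

lemma p_group_dvd_index:
  fixes G (structure)
  assumes p: "Factorial_Ring.prime p" and G: "p_group p G" and H: "subgroup H G"
    and fin: "finite (rcosets H)" and proper: "H \<noteq> carrier G"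
  shows "p dvd card (rcosets H)"
proof -
  interpret group G using G by (simp add: p_group_def)
  let ?\<phi> = "\<lambda>g. \<lambda>C\<in>rcosets H. C #> inv g"
  obtain k where k: "k \<in> carrier G" "k \<notin> H" using proper subgroup.subset[OF H] by blast
  have "\<exists>g\<in>carrier G. ?\<phi> g C \<noteq> C" if C: "C \<in> rcosets H" for C
  proof -
    obtain x where x: "x \<in> carrier G" "C = H #> x" using C by (auto simp: RCOSETS_def)
    \<comment> \<open>chosen so that it moves the coset of \<open>x\<close> to the coset of \<open>k x\<close>\<close>
    let ?g = "inv x \<otimes> inv k \<otimes> x"
    have "x \<otimes> inv ?g = k \<otimes> x"
      using x(1) k(1) by (simp add: inv_mult_group m_assoc[symmetric])
    then have "?\<phi> ?g C = H #> (k \<otimes> x)"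
      using C x k(1) subgroup.subset[OF H] by (simp add: coset_mult_assoc)
    moreover have "k \<otimes> x \<notin> C"
      using x k subgroup.rcos_module[OF H is_group x(1), of "k \<otimes> x"] by (simp add: m_assoc)
    ultimately have "?\<phi> ?g C \<noteq> C" using rcos_self[OF _ H, of "k \<otimes> x"] x(1) k(1) by auto
    then show ?thesis using x(1) k(1) by (intro bexI[of _ ?g]) auto
  qed
  then have "{C \<in> rcosets H. \<exists>g\<in>carrier G. ?\<phi> g C \<noteq> C} = rcosets H" by blast
  then show ?thesis using p_group_dvd_card_moved_points[OF p G coset_action[OF H] fin] by simp
qed

text \<open>
  A coset \<open>H g\<close> is fixed under right multiplication by \<open>H\<close> iff \<open>g H g\<inverse> \<subseteq> H\<close>. The number of cosets
  and the number of cosets that move are both divisible by \<open>p\<close>, hence so is the number of fixed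
  ones. The coset \<open>H\<close> is fixed, so there is another.
\<close>

lemma p_group_normalizer_grows:
  fixes G (structure)
  assumes p: "Factorial_Ring.prime p" and G: "p_group p G" and H: "subgroup H G"
    and fin: "finite (rcosets H)" and proper: "H \<noteq> carrier G"
  obtains g where "g \<in> carrier G" "g \<notin> H" "\<forall>h\<in>H. g \<otimes> h \<otimes> inv g \<in> H"
proof -
  interpret group G using G by (simp add: p_group_def)
  let ?\<phi> = "\<lambda>g. \<lambda>C\<in>rcosets H. C #> inv g"
  define Mov where "Mov = {C \<in> rcosets H. \<exists>h\<in>H. ?\<phi> h C \<noteq> C}"
  have Hin: "H \<in> rcosets H" using subgroup.subgroup_in_rcosets[OF H is_group] .
  have "p dvd card Mov"
    using p_group_dvd_card_moved_points[OF p p_group_subgroup[OF p G H]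
        group_action.induced_action[OF coset_action[OF H] H] fin] by (simp add: Mov_def)
  moreover have "card (rcosets H - Mov) = card (rcosets H) - card Mov"
    using fin by (intro card_Diff_subset) (auto simp: Mov_def)
  ultimately have "p dvd card (rcosets H - Mov)"
    using p_group_dvd_index[OF assms] by (simp add: dvd_diff_nat)
  moreover have "H \<in> rcosets H - Mov"
    using Hin subgroup.m_inv_closed[OF H] subgroup.mem_carrier[OF H]
    by (auto simp: Mov_def coset_join2[OF _ H])
  ultimately have "rcosets H - Mov \<noteq> {H}" using p by auto
  then obtain C where C: "C \<in> rcosets H" "C \<notin> Mov" "C \<noteq> H"
    using \<open>H \<in> rcosets H - Mov\<close> by blast
  then obtain g where g: "g \<in> carrier G" "C = H #> g" by (auto simp: RCOSETS_def)
  have "g \<notin> H" using C(3) g H coset_join2 by blast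
  moreover have "g \<otimes> h \<otimes> inv g \<in> H" if h: "h \<in> H" for h
  proof -
    have hG: "h \<in> carrier G" using h H subgroup.mem_carrier by metis
    have "?\<phi> (inv h) C = C" using C h subgroup.m_inv_closed[OF H] by (auto simp: Mov_def)
    then have "H #> (g \<otimes> h) = H #> g"
      using C g hG subgroup.subset[OF H] by (simp add: coset_mult_assoc)
    then have "g \<otimes> h \<in> H #> g" using rcos_self[OF _ H, of "g \<otimes> h"] g(1) hG by simp
    then show ?thesis using subgroup.rcos_module[OF H is_group g(1)] g(1) hG by blast
  qed
  ultimately show thesis using g(1) that by blast
qed

lemma p_group_maximal_subgroup_normal:
  fixes G (structure)
  assumes p: "Factorial_Ring.prime p" and G: "p_group p G" and M: "subgroup M G"
    and fin: "finite (rcosets M)" and proper: "M \<noteq> carrier G"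
    and max: "\<And>L. subgroup L G \<Longrightarrow> M \<subseteq> L \<Longrightarrow> L \<noteq> M \<Longrightarrow> L = carrier G"
  shows "M \<lhd> G"
proof -
  interpret group G using G by (simp add: p_group_def)
  define L where "L = {g \<in> carrier G. \<forall>h\<in>M. g \<otimes> h \<otimes> inv g \<in> M}"
  have MG: "x \<in> carrier G" if "x \<in> M" for x using that M subgroup.mem_carrier by metis
  have "submonoid L G"
  proof
    show "L \<subseteq> carrier G" by (auto simp: L_def)
    show "\<one> \<in> L" using MG by (auto simp: L_def)
    fix x y assume xy: "x \<in> L" "y \<in> L"
    have "x \<otimes> y \<otimes> h \<otimes> inv (x \<otimes> y) \<in> M" if "h \<in> M" for h
    proof -
      have "x \<otimes> (y \<otimes> h \<otimes> inv y) \<otimes> inv x \<in> M" using xy that by (auto simp: L_def)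
      then show ?thesis using xy MG[OF that] by (auto simp: L_def inv_mult_group m_assoc)
    qed
    then show "x \<otimes> y \<in> L" using xy by (auto simp: L_def)
  qed
  then have "subgroup L G" by (rule p_group_submonoid_is_subgroup[OF p G])
  moreover have "M \<subseteq> L"
    using MG subgroup.m_closed[OF M] subgroup.m_inv_closed[OF M] by (auto simp: L_def)
  moreover have "L \<noteq> M"
  proof -
    obtain g where "g \<in> carrier G" "g \<notin> M" "\<forall>h\<in>M. g \<otimes> h \<otimes> inv g \<in> M"
      using p_group_normalizer_grows[OF p G M fin proper] .
    then have "g \<in> L" "g \<notin> M" by (auto simp: L_def)
    then show ?thesis by blast
  qed
  ultimately have "L = carrier G" by (rule max)
  then show ?thesis using M by (intro normal_invI) (auto simp: L_def)
qed

text \<open>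
  By maximality the quotient has no subgroups besides the trivial one and itself. It is a
  nontrivial finite \<open>p\<close>-group, so by Sylow it contains a subgroup of order \<open>p\<close>, which must be the
  whole quotient.
\<close>

lemma p_group_maximal_normal_index:
  fixes G (structure)
  assumes p: "Factorial_Ring.prime p" and G: "p_group p G" and M: "M \<lhd> G"
    and fin: "finite (rcosets M)" and proper: "M \<noteq> carrier G"
    and max: "\<And>L. subgroup L G \<Longrightarrow> M \<subseteq> L \<Longrightarrow> L \<noteq> M \<Longrightarrow> L = carrier G"
  shows "card (rcosets M) = p"
proof -
  interpret group G using G by (simp add: p_group_def)
  interpret M: normal M G by fact
  let ?Q = "G Mod M"
  interpret Q: group ?Q by (rule M.factorgroup_is_group)
  interpret h: group_hom G ?Q "\<lambda>g. M #> g"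
    using M.r_coset_hom_Mod by unfold_locales
  have "?Q\<lparr>carrier := (\<lambda>g. M #> g) ` carrier G\<rparr> = ?Q"
    by (simp add: carrier_FactGroup[symmetric])
  then have "p_group p ?Q" using p_group_hom_image[OF p G h.group_hom_axioms] by simp
  moreover have cQ: "carrier ?Q = rcosets M" by (simp add: FactGroup_def)
  ultimately obtain n where n: "order ?Q = p ^ n"
    using finite_p_group_order[OF p, of ?Q] fin by auto
  obtain k where k: "k \<in> carrier G" "k \<notin> M" using proper M.subset by blast
  have "order ?Q \<noteq> 1"
  proof
    assume "order ?Q = 1"
    then obtain C where "rcosets M = {C}" by (auto simp: order_def cQ card_1_singleton_iff)
    then have "M #> k = M"
      using rcosetsI[OF M.subset k(1)] M.subgroup_in_rcosets[OF is_group] by auto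
    then show False using k rcos_self[OF k(1) M.subgroup_axioms] by simp
  qed
  then have "order ?Q = p ^ 1 * p ^ (n - 1)"
    using n by (cases n) auto
  then obtain K where K: "subgroup K ?Q" "card K = p"
    using sylow_thm[OF p Q.is_group] fin cQ by (metis power_one_right)
  define L where "L = {g \<in> carrier G. M #> g \<in> K}"
  have "subgroup L G"
  proof (rule subgroupI)
    have "\<one> \<in> L" using subgroup.one_closed[OF K(1)] M.subset by (simp add: L_def)
    then show "L \<noteq> {}" by blast
    show "inv a \<in> L" if "a \<in> L" for a
    proof -
      have a: "a \<in> carrier G" "M #> a \<in> K" using that by (auto simp: L_def)
      then have "M #> inv a \<in> K" using subgroup.m_inv_closed[OF K(1)] h.hom_inv[OF a(1)] by metis
      then show ?thesis using a(1) by (simp add: L_def)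
    qed
    show "a \<otimes> b \<in> L" if "a \<in> L" "b \<in> L" for a b
    proof -
      have ab: "a \<in> carrier G" "M #> a \<in> K" "b \<in> carrier G" "M #> b \<in> K"
        using that by (auto simp: L_def)
      then have "M #> (a \<otimes> b) \<in> K"
        using subgroup.m_closed[OF K(1) ab(2,4)] h.hom_mult[OF ab(1,3)] by metis
      then show ?thesis using ab by (simp add: L_def)
    qed
  qed (auto simp: L_def)
  moreover have "M \<subseteq> L"
    using subgroup.one_closed[OF K(1)] coset_join2[OF _ M.subgroup_axioms] M.subset
    by (auto simp: L_def)
  moreover have "L \<noteq> M"
  proof
    assume "L = M"
    have "C = M" if "C \<in> K" for C
    proof -
      have "C \<in> rcosets M" using that subgroup.subset[OF K(1)] cQ by blast
      then obtain g where g: "g \<in> carrier G" "C = M #> g" by (auto simp: RCOSETS_def)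
      then have "g \<in> M" using that \<open>L = M\<close> by (auto simp: L_def)
      then show ?thesis using g coset_join2[OF _ M.subgroup_axioms] by simp
    qed
    then have "K \<subseteq> {M}" by blast
    then have "card K \<le> 1" using card_mono[of "{M}" K] by simp
    then show False using K(2) prime_gt_1_nat[OF p] by simp
  qed
  ultimately have "L = carrier G" by (rule max)
  then have "K = rcosets M"
    using subgroup.subset[OF K(1)] cQ by (auto simp: L_def RCOSETS_def)
  then show ?thesis using K(2) by simp
qed

text \<open>
  A maximal proper subgroup above \<open>H\<close> is normal since its normalizer is larger.
\<close>

lemma p_group_normal_index_p:
  fixes G (structure)
  assumes p: "Factorial_Ring.prime p" and G: "p_group p G" and H: "subgroup H G"
    and fin: "finite (rcosets H)" and proper: "H \<noteq> carrier G"
  obtains M where "M \<lhd> G" "H \<subseteq> M" "finite (rcosets M)" "card (rcosets M) = p"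
proof -
  interpret group G using G by (simp add: p_group_def)
  let ?S = "{L. subgroup L G \<and> H \<subseteq> L \<and> L \<noteq> carrier G}"
  have "finite ?S" by (rule finite_subset[OF _ finite_supergroups[OF H fin]]) auto
  moreover have "H \<in> ?S" using H proper by simp
  ultimately obtain M where M: "M \<in> ?S" and max: "\<forall>L\<in>?S. M \<subseteq> L \<longrightarrow> M = L"
    using finite_has_maximal[of ?S] by auto
  have fM: "finite (rcosets M)" using finite_rcosets_supergroup[OF H _ _ fin] M by simp
  have max': "L = carrier G" if "subgroup L G" "M \<subseteq> L" "L \<noteq> M" for L
    using that M max by blast
  have n: "M \<lhd> G" using p_group_maximal_subgroup_normal[OF p G _ fM _ max'] M by blast
  then have "card (rcosets M) = p" using p_group_maximal_normal_index[OF p G _ fM _ max'] M by blast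
  then show thesis using n fM M that by blast
qed

section \<open>Orbits of subgroups\<close>

lemma (in group_action) orbit_eq_of_mem:
  assumes "x \<in> E" "y \<in> orbit G \<phi> x"
  shows "orbit G \<phi> y = orbit G \<phi> x"
proof -
  obtain g where "g \<in> carrier G" "\<phi> g x = y" using assms(2) by (auto simp: orbit_def)
  then have "y \<in> E" using element_image assms(1) by blast
  then have "y \<in> orbit G \<phi> y" "orbit G \<phi> y \<in> orbits G E \<phi>"
    by (auto intro: orbit_refl simp: orbits_def)
  moreover have "orbit G \<phi> x \<in> orbits G E \<phi>" using assms(1) by (auto simp: orbits_def)
  ultimately show ?thesis using disjoint_union assms(2) by blast
qed

lemma orbit_restrict_mono: "M \<subseteq> U \<Longrightarrow> orbit (G\<lparr>carrier := M\<rparr>) \<phi> x \<subseteq> orbit (G\<lparr>carrier := U\<rparr>) \<phi> x"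
  by (auto simp: orbit_def)

lemma (in group_action) card_orbits_subgroup_mono:
  assumes U: "subgroup U G" and M: "subgroup M G" and MU: "M \<subseteq> U"
    and fin: "finite (orbits (G\<lparr>carrier := M\<rparr>) E \<phi>)"
  shows "card (orbits (G\<lparr>carrier := U\<rparr>) E \<phi>) \<le> card (orbits (G\<lparr>carrier := M\<rparr>) E \<phi>)"
proof -
  interpret U: group_action "G\<lparr>carrier := U\<rparr>" E \<phi> using induced_action[OF U] .
  interpret M: group_action "G\<lparr>carrier := M\<rparr>" E \<phi> using induced_action[OF M] .
  let ?oU = "orbit (G\<lparr>carrier := U\<rparr>) \<phi>" and ?oM = "orbit (G\<lparr>carrier := M\<rparr>) \<phi>"
  have "?oU x = \<Union> (?oU ` ?oM x)" if x: "x \<in> E" for x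
  proof -
    have "?oM x \<subseteq> ?oU x" using orbit_restrict_mono[OF MU] .
    then have "?oU y = ?oU x" if "y \<in> ?oM x" for y using U.orbit_eq_of_mem[OF x] that by blast
    then show ?thesis using M.orbit_refl[OF x] by blast
  qed
  then have "orbits (G\<lparr>carrier := U\<rparr>) E \<phi> \<subseteq> (\<lambda>Z. \<Union> (?oU ` Z)) ` orbits (G\<lparr>carrier := M\<rparr>) E \<phi>"
    by (auto simp: orbits_def)
  then show ?thesis by (rule surj_card_le[OF fin])
qed

text \<open>
  Passing from \<open>G\<close> to \<open>M\<close>, the orbit of \<open>x\<close> falls apart into \<open>|G : M|\<close> orbits: \<open>M g \<mapsto> M g x\<close> maps
  the cosets of \<open>M\<close> to these orbits, and it is injective because \<open>M\<close> is normal and contains the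
  stabilizer of \<open>x\<close>. Every other orbit of \<open>G\<close> contains at least one orbit of \<open>M\<close>.
\<close>

lemma (in group_action) normal_subgroup_splits_orbit:
  assumes M: "M \<lhd> G" and x: "x \<in> E" and stab: "stabilizer G \<phi> x \<subseteq> M"
    and fin: "finite (orbits (G\<lparr>carrier := M\<rparr>) E \<phi>)"
  shows "card (orbits G E \<phi>) + card (rcosets M) \<le> card (orbits (G\<lparr>carrier := M\<rparr>) E \<phi>) + 1"
proof -
  interpret group G using group_hom group_hom.axioms(1) by auto
  interpret N: normal M G by fact
  have M': "subgroup M G" by (rule N.subgroup_axioms)
  interpret M: group_action "G\<lparr>carrier := M\<rparr>" E \<phi> using induced_action[OF M'] .
  let ?oM = "orbit (G\<lparr>carrier := M\<rparr>) \<phi>" and ?Y = "orbit G \<phi> x"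
  let ?O = "orbits (G\<lparr>carrier := M\<rparr>) E \<phi>"
  \<comment> \<open>the orbit of \<open>g x\<close> under \<open>M\<close> is the image of the coset of \<open>g\<close> under evaluation at \<open>x\<close>,
    a description that does not depend on the choice of \<open>g\<close>\<close>
  define f where "f C = (\<lambda>h. \<phi> h x) ` C" for C
  have f: "f (M #> g) = ?oM (\<phi> g x)" if "g \<in> carrier G" for g
  proof -
    have "f (M #> g) = {\<phi> (m \<otimes> g) x | m. m \<in> M}" by (auto simp: f_def r_coset_def)
    also have "\<dots> = {\<phi> m (\<phi> g x) | m. m \<in> M}"
      using composition_rule[OF x N.mem_carrier that] by (metis (no_types, lifting))
    finally show ?thesis by (simp add: orbit_def)
  qed
  have inj: "inj_on f (rcosets M)"
  proof
    fix C D assume "C \<in> rcosets M" "D \<in> rcosets M" and eq: "f C = f D"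
    then obtain g h where g: "g \<in> carrier G" "C = M #> g" and h: "h \<in> carrier G" "D = M #> h"
      by (auto simp: RCOSETS_def)
    have "\<phi> g x \<in> f C" using g rcos_self[OF g(1) M'] by (simp add: f_def)
    then obtain m where m: "m \<in> M" "\<phi> g x = \<phi> (m \<otimes> h) x"
      using eq h by (auto simp: f_def r_coset_def)
    have mG: "m \<in> carrier G" using m(1) N.mem_carrier by simp
    have "\<phi> (inv g \<otimes> (m \<otimes> h)) x = \<phi> (inv g) (\<phi> g x)"
      using composition_rule[OF x, of "inv g" "m \<otimes> h"] g(1) h(1) mG m(2) by simp
    also have "\<dots> = x" using orbit_sym_aux[OF g(1) x] by simp
    finally have "inv g \<otimes> (m \<otimes> h) \<in> M"
      using stab g(1) h(1) mG by (auto simp: stabilizer_def)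
    then have "g \<otimes> (inv g \<otimes> (m \<otimes> h)) \<otimes> inv g \<in> M"
      using N.inv_op_closed2[OF g(1)] by blast
    then have "m \<otimes> h \<otimes> inv g \<in> M" using g(1) h(1) mG by (simp add: m_assoc[symmetric])
    then have "m \<otimes> h \<in> M #> g" using N.rcos_module[OF is_group g(1)] h(1) mG by blast
    moreover have "m \<otimes> h \<in> M #> h" using m(1) by (auto simp: r_coset_def)
    ultimately show "C = D"
      using g h repr_independence[OF _ _ M'] by metis
  qed
  \<comment> \<open>a point in each of the other orbits of \<open>G\<close>, whose orbit under \<open>M\<close> stays inside\<close>
  define rep where "rep Q = (SOME y. y \<in> Q)" for Q :: "'c set"
  have rep: "rep Q \<in> E \<and> orbit G \<phi> (rep Q) = Q" if Q: "Q \<in> orbits G E \<phi>" for Q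
  proof -
    obtain y where y: "y \<in> E" "Q = orbit G \<phi> y" using Q by (auto simp: orbits_def)
    have "y \<in> Q" using orbit_refl[OF y(1)] y(2) by simp
    then have "rep Q \<in> Q" unfolding rep_def by (rule someI)
    moreover have "Q \<subseteq> E" using orbits_coverture Q by blast
    ultimately show ?thesis using y orbit_eq_of_mem[OF y(1)] by blast
  qed
  have sub: "?oM y \<subseteq> orbit G \<phi> y" for y
    using N.subset by (auto simp: orbit_def)
  let ?A = "f ` (rcosets M)" and ?B = "(\<lambda>Q. ?oM (rep Q)) ` (orbits G E \<phi> - {?Y})"
  have same: "Q = Q'" if "Q \<in> orbits G E \<phi>" "Q' \<in> orbits G E \<phi>" "z \<in> Q'" "z \<in> ?oM (rep Q)" for Q Q' z
  proof -
    have "z \<in> Q" using that rep[of Q] sub[of "rep Q"] by blast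
    then show ?thesis using disjoint_union that by blast
  qed
  have mem: "rep Q \<in> ?oM (rep Q)" if "Q \<in> orbits G E \<phi>" for Q
    using M.orbit_refl rep that by blast
  have injB: "inj_on (\<lambda>Q. ?oM (rep Q)) (orbits G E \<phi> - {?Y})"
  proof
    fix Q Q' assume Q: "Q \<in> orbits G E \<phi> - {?Y}" "Q' \<in> orbits G E \<phi> - {?Y}"
      and eq: "?oM (rep Q) = ?oM (rep Q')"
    have "rep Q' \<in> Q'" using rep[of Q'] orbit_refl[of "rep Q'"] Q(2) by simp
    moreover have "rep Q' \<in> ?oM (rep Q)" using eq mem[of Q'] Q(2) by simp
    ultimately show "Q = Q'" using same Q by blast
  qed
  have Y: "?Y \<in> orbits G E \<phi>" using x by (auto simp: orbits_def)
  have AY: "Z \<subseteq> ?Y" if "Z \<in> ?A" for Z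
  proof -
    obtain C where C: "C \<in> rcosets M" "Z = f C" using \<open>Z \<in> ?A\<close> by blast
    then show ?thesis using N.rcosets_carrier[OF is_group C(1)] by (auto simp: f_def orbit_def)
  qed
  have "?A \<inter> ?B = {}"
  proof (rule ccontr)
    assume "?A \<inter> ?B \<noteq> {}"
    then obtain Q where Q: "Q \<in> orbits G E \<phi>" "Q \<noteq> ?Y" "?oM (rep Q) \<in> ?A" by blast
    then have "rep Q \<in> ?Y" using AY mem by blast
    then show False using same[OF Q(1) Y _ mem[OF Q(1)]] Q(2) by blast
  qed
  moreover have "?A \<subseteq> ?O"
  proof
    fix Z assume "Z \<in> ?A"
    then obtain g where g: "g \<in> carrier G" "Z = ?oM (\<phi> g x)" using f by (auto simp: RCOSETS_def)
    then show "Z \<in> ?O" using element_image[OF g(1) x] by (auto simp: orbits_def)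
  qed
  moreover have "?B \<subseteq> ?O" using rep by (auto simp: orbits_def)
  ultimately have "card ?A + card ?B \<le> card ?O"
    using fin card_Un_disjoint[of ?A ?B] card_mono[OF fin, of "?A \<union> ?B"]
    by (simp add: finite_subset)
  moreover have "card ?A = card (rcosets M)" using inj by (rule card_image)
  moreover have "card ?B = card (orbits G E \<phi>) - 1"
    using card_image[OF injB] Y by simp
  ultimately show ?thesis by linarith
qed

section \<open>Descending to subgroups with many orbits\<close>

text \<open>
  If \<open>N\<close> has more orbits than \<open>U\<close>, then some orbit \<open>U x\<close> is larger than \<open>N x\<close>. The setwise
  stabilizer \<open>H\<close> of \<open>N x\<close> in \<open>U\<close> is then a proper subgroup of \<open>U\<close>. It contains \<open>N\<close>, hence has
  finite index, and also the stabilizer of \<open>x\<close>. A normal subgroup of index \<open>p\<close> in \<open>U\<close> above \<open>H\<close>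
  splits \<open>U x\<close> into \<open>p\<close> orbits.
\<close>

lemma (in transitive_action) p_group_gain_orbits:
  assumes p: "Factorial_Ring.prime p" and G: "p_group p G"
    and N: "N \<lhd> G" and finN: "finite (rcosets N)"
    and U: "subgroup U G" and NU: "N \<subseteq> U"
    and less: "card (orbits (G\<lparr>carrier := U\<rparr>) E \<phi>) < card (orbits (G\<lparr>carrier := N\<rparr>) E \<phi>)"
  obtains M where "subgroup M G" "N \<subseteq> M" "card (rcosets M) \<le> p * card (rcosets U)"
    and "card (orbits (G\<lparr>carrier := U\<rparr>) E \<phi>) + (p - 1) \<le> card (orbits (G\<lparr>carrier := M\<rparr>) E \<phi>)"
proof -
  interpret group G using G by (simp add: p_group_def)
  interpret N: normal N G by fact
  let ?GU = "G\<lparr>carrier := U\<rparr>"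
  interpret GU: group ?GU using subgroup_imp_group[OF U] .
  interpret U: group_action ?GU E \<phi> using induced_action[OF U] .
  let ?oN = "orbit (G\<lparr>carrier := N\<rparr>) \<phi>"
  interpret aN: group_action "G\<lparr>carrier := N\<rparr>" E \<phi> using induced_action[OF N.subgroup_axioms] .
  have UG: "u \<in> carrier G" if "u \<in> U" for u using that U subgroup.mem_carrier by metis
  have "orbits ?GU E \<phi> \<noteq> orbits (G\<lparr>carrier := N\<rparr>) E \<phi>" using less by auto
  then obtain x where x: "x \<in> E" "?oN x \<noteq> orbit ?GU \<phi> x" by (auto simp: orbits_def)
  \<comment> \<open>the stabilizer of the set \<open>N x\<close>: as \<open>N\<close> is normal, \<open>u\<close> maps \<open>N x\<close> to \<open>N u x\<close>\<close>
  define H where "H = {u \<in> U. \<phi> u x \<in> ?oN x}"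
  have NH: "N \<subseteq> H" using NU by (auto simp: H_def orbit_def)
  have "submonoid H ?GU"
  proof
    show "H \<subseteq> carrier ?GU" by (auto simp: H_def)
    show "\<one>\<^bsub>?GU\<^esub> \<in> H" using NH N.one_closed by auto
    fix u v assume u: "u \<in> H" and v: "v \<in> H"
    then have uv: "u \<in> U" "v \<in> U" by (auto simp: H_def)
    obtain n where n: "n \<in> N" "\<phi> v x = \<phi> n x" using v by (auto simp: H_def orbit_def)
    obtain k where k: "k \<in> N" "\<phi> u x = \<phi> k x" using u by (auto simp: H_def orbit_def)
    let ?n = "u \<otimes> n \<otimes> inv u"
    have n': "?n \<in> N" using N.inv_op_closed2 UG uv n(1) by blast
    have nG: "n \<in> carrier G" "k \<in> carrier G" "?n \<in> carrier G" using n(1) k(1) n' N.mem_carrier by auto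
    have "\<phi> (u \<otimes> v) x = \<phi> (u \<otimes> n) x"
      using composition_rule[OF x(1)] UG uv nG n(2) by simp
    also have "u \<otimes> n = ?n \<otimes> u" using UG[OF uv(1)] nG by (simp add: m_assoc)
    also have "\<phi> (?n \<otimes> u) x = \<phi> (?n \<otimes> k) x"
      using composition_rule[OF x(1), of ?n] UG[OF uv(1)] nG k(2) by metis
    finally have "\<phi> (u \<otimes> v) x \<in> ?oN x" using n' k(1) by (auto simp: orbit_def)
    then show "u \<otimes>\<^bsub>?GU\<^esub> v \<in> H" using subgroup.m_closed[OF U] uv by (simp add: H_def)
  qed
  then have H: "subgroup H ?GU"
    using p_group_submonoid_is_subgroup[OF p p_group_subgroup[OF p G U]] by blast
  have "?oN x \<subseteq> orbit ?GU \<phi> x" using orbit_restrict_mono[OF NU] .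
  then have "H \<noteq> carrier ?GU" using x(2) by (auto simp: H_def orbit_def)
  moreover have "finite (rcosets\<^bsub>?GU\<^esub> H)"
  proof (rule GU.finite_rcosets_supergroup[OF _ H NH])
    show "subgroup N ?GU" using subgroup_incl[OF N.subgroup_axioms U NU] .
    show "finite (rcosets\<^bsub>?GU\<^esub> N)"
      by (rule finite_subset[OF _ finN]) (use UG in \<open>auto simp: RCOSETS_def\<close>)
  qed
  ultimately obtain M where M: "M \<lhd> ?GU" "H \<subseteq> M" "finite (rcosets\<^bsub>?GU\<^esub> M)"
    "card (rcosets\<^bsub>?GU\<^esub> M) = p"
    using p_group_normal_index_p[OF p p_group_subgroup[OF p G U] H] by blast
  have MU: "M \<subseteq> U" using subgroup.subset[OF normal_imp_subgroup[OF M(1)]] by simp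
  have MG: "subgroup M G" using incl_subgroup[OF U normal_imp_subgroup[OF M(1)]] .
  have finU: "finite (rcosets U)"
    using finite_rcosets_supergroup[OF N.subgroup_axioms U NU finN] .
  have finM: "finite (rcosets M)" using card_rcosets_tower(1)[OF U MG MU finU M(3)] .
  have "stabilizer ?GU \<phi> x \<subseteq> M"
    using M(2) aN.orbit_refl[OF x(1)] by (auto simp: stabilizer_def H_def)
  moreover have "finite (orbits (?GU\<lparr>carrier := M\<rparr>) E \<phi>)"
    using orbits_subgroup_finite_index(1)[OF MG finM] by simp
  ultimately have "card (orbits ?GU E \<phi>) + p \<le> card (orbits (G\<lparr>carrier := M\<rparr>) E \<phi>) + 1"
    using U.normal_subgroup_splits_orbit[OF M(1) x(1)] M(4) by simp
  then have "card (orbits ?GU E \<phi>) + (p - 1) \<le> card (orbits (G\<lparr>carrier := M\<rparr>) E \<phi>)"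
    using prime_gt_0_nat[OF p] by linarith
  moreover have "card (rcosets M) \<le> p * card (rcosets U)"
    using card_rcosets_tower(2)[OF U MG MU finU M(3)] M(4) by simp
  ultimately show thesis using that MG M(2) NH by blast
qed

text \<open>
  As long as fewer than \<open>(p - 1) m + 1\<close> orbits are reached, \<open>N\<close> has more, so the descent goes on.
  The target for \<open>j + 1\<close> may already be met by the subgroup found for \<open>j\<close>; the index is only
  bounded from above, so that subgroup can then be kept.
\<close>

lemma (in transitive_action) p_group_many_orbits:
  assumes p: "Factorial_Ring.prime p" and G: "p_group p G"
    and N: "N \<lhd> G" and finN: "finite (rcosets N)"
    and many: "(p - 1) * m + 1 \<le> card (orbits (G\<lparr>carrier := N\<rparr>) E \<phi>)"
    and "j \<le> m"
  shows "\<exists>U. subgroup U G \<and> N \<subseteq> U \<and> card (rcosets U) \<le> p ^ j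
    \<and> (p - 1) * j + 1 \<le> card (orbits (G\<lparr>carrier := U\<rparr>) E \<phi>)"
  using \<open>j \<le> m\<close>
proof (induction j)
  case 0
  interpret group G using G by (simp add: p_group_def)
  interpret N: normal N G by fact
  have "rcosets (carrier G) \<subseteq> {carrier G}"
    using coset_join2[OF _ subgroup_self] unfolding RCOSETS_def by blast
  then have "card (rcosets (carrier G)) \<le> 1" using card_mono[of "{carrier G}"] by simp
  moreover have "card (orbits G E \<phi>) \<ge> 1"
  proof -
    have "E \<noteq> {}" using many by (auto simp: orbits_def)
    then show ?thesis using one_orbit by simp
  qed
  ultimately show ?case using subgroup_self N.subset by (intro exI[of _ "carrier G"]) simp
next
  case (Suc j)
  then obtain U where U: "subgroup U G" "N \<subseteq> U" "card (rcosets U) \<le> p ^ j"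
    "(p - 1) * j + 1 \<le> card (orbits (G\<lparr>carrier := U\<rparr>) E \<phi>)" by auto
  have pos: "p > 0" using p prime_gt_0_nat by blast
  show ?case
  proof (cases "(p - 1) * Suc j + 1 \<le> card (orbits (G\<lparr>carrier := U\<rparr>) E \<phi>)")
    case True
    have "p ^ j \<le> p ^ Suc j" using pos by simp
    then show ?thesis using U True by (meson le_trans)
  next
    case False
    have "(p - 1) * Suc j \<le> (p - 1) * m" using Suc.prems by (rule mult_le_mono2)
    then have "card (orbits (G\<lparr>carrier := U\<rparr>) E \<phi>) < card (orbits (G\<lparr>carrier := N\<rparr>) E \<phi>)"
      using False many by linarith
    then obtain M where M: "subgroup M G" "N \<subseteq> M" "card (rcosets M) \<le> p * card (rcosets U)"
      "card (orbits (G\<lparr>carrier := U\<rparr>) E \<phi>) + (p - 1) \<le> card (orbits (G\<lparr>carrier := M\<rparr>) E \<phi>)"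
      using p_group_gain_orbits[OF p G N finN U(1,2)] by blast
    have "card (rcosets M) \<le> p ^ Suc j" using le_trans[OF M(3) mult_le_mono2[OF U(3)]] by simp
    moreover have "(p - 1) * Suc j + 1 \<le> card (orbits (G\<lparr>carrier := M\<rparr>) E \<phi>)" using M(4) U(4) by simp
    ultimately show ?thesis using M by blast
  qed
qed

theorem theorem9:
  fixes G :: "('a, 'b) monoid_scheme"
    and E :: "'c set"
    and \<phi> :: "'a \<Rightarrow> 'c \<Rightarrow> 'c"
    and p :: nat
  assumes "Factorial_Ring.prime p"
    and "p_group p G"
    and "transitive_action G E \<phi>"
    and "\<not> bdd_above (max_orbits G E \<phi> ` {1..})"
  shows "infinite {m::nat. max_orbits G E \<phi> (p ^ m) \<ge> (p - 1) * m + 1}"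
proof -
  interpret transitive_action G E \<phi> by fact
  interpret group G using assms(2) by (simp add: p_group_def)
  have "max_orbits G E \<phi> (p ^ m) \<ge> (p - 1) * m + 1" for m
  proof -
    let ?k = "(p - 1) * m + 1"
    obtain n where n: "n \<ge> 1" "?k \<le> max_orbits G E \<phi> n"
      using assms(4) unfolding bdd_above_def by (metis atLeast_iff image_iff linear)
    have "max_orbits G E \<phi> n \<in> {card (orbits (G\<lparr>carrier := U\<rparr>) E \<phi>) | U. subgroup_of_index_at_most G n U}"
      unfolding max_orbits_def using max_orbits_well_defined n(1) by (intro Max_in) auto
    then obtain V where V: "subgroup V G" "finite (rcosets\<^bsub>G\<^esub> V)"
      "max_orbits G E \<phi> n = card (orbits (G\<lparr>carrier := V\<rparr>) E \<phi>)"
      by (auto simp: subgroup_of_index_at_most_def)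
    obtain N where N: "N \<lhd> G" "N \<subseteq> V" "finite (rcosets\<^bsub>G\<^esub> N)"
      using finite_index_contains_normal[OF V(1,2)] .
    have N': "subgroup N G" using normal_imp_subgroup[OF N(1)] .
    have "?k \<le> card (orbits (G\<lparr>carrier := N\<rparr>) E \<phi>)"
      using card_orbits_subgroup_mono[OF V(1) N' N(2) orbits_subgroup_finite_index(1)[OF N' N(3)]]
        n(2) V(3) by linarith
    then obtain U where U: "subgroup U G" "N \<subseteq> U" "card (rcosets\<^bsub>G\<^esub> U) \<le> p ^ m"
      "?k \<le> card (orbits (G\<lparr>carrier := U\<rparr>) E \<phi>)"
      using p_group_many_orbits[OF assms(1,2) N(1,3) _ order_refl] by blast
    have "finite (rcosets\<^bsub>G\<^esub> U)" using finite_rcosets_supergroup[OF N' U(1,2) N(3)] .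
    then have "subgroup_of_index_at_most G (p ^ m) U"
      using U by (simp add: subgroup_of_index_at_most_def)
    then have "card (orbits (G\<lparr>carrier := U\<rparr>) E \<phi>) \<le> max_orbits G E \<phi> (p ^ m)"
      unfolding max_orbits_def using max_orbits_well_defined(1) by (intro Max_ge) auto
    then show ?thesis using U(4) by linarith
  qed
  then have "{m::nat. max_orbits G E \<phi> (p ^ m) \<ge> (p - 1) * m + 1} = UNIV" by blast
  then show ?thesis by simp
qed

end
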